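(* Let $X$ be a Lindelöf metric space with metric $d$ and let $T:X\to X$ be a pointwise equicontinuous map. Then there is no nonatomic invariant Borel probability measure $\mu$ of $T$ with positive expansion exponent, i.e. with $E_\mu(T)>0$.
   Context: A metric space $X$ is Lindelöf if every open cover has a countable subcover. A point $x\in X$ is an equicontinuous point of $T:X\to X$ if for every $\epsilon>0$ there is $\delta>0$ such that if $y\in X$ and $d(x,y)<\delta$, then $d(T^i(x),T^i(y))<\epsilon$ for all integers $i\geq0$. $T$ is pointwise equicontinuous if every point of $X$ is an equicontinuous point of $T$ (such a map is continuous, hence Borel measurable). A Borel probability measure of $X$ is a $\sigma$-additive measure $\mu$ on the Borel $\sigma$-algebra of $X$ with $\mu(X)=1$. It is nonatomic if $\mu(\{x\})=0$ for all $x\in X$, and invariant (for $T$) if $\mu(T^{-1}(B))=\mu(B)$ for all Borel sets $B\subset X$. $B(x,\epsilon)$ denotes the open ball of radius $\epsilon$ centered at $x$. For a Borel probability measure $\mu$, the expansion exponent of $\mu$ with respect to $T$ is $$E_\mu(T)=\sup\{\lambda\in\mathbb{R}\mid \exists\,\epsilon>0 \text{ such that } \mu(\{y\in B(x,\epsilon)\mid d(T(x),T(y))<e^\lambda d(x,y)\})=0 \text{ for all } x\in X\},$$ with the convention $\sup\emptyset=-\infty$ (the value lies in $[-\infty,+\infty]$). *)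

theory Defs
  imports "HOL-Probability.Probability"
begin

definition equicontinuous_point :: "('a::metric_space \<Rightarrow> 'a) \<Rightarrow> 'a \<Rightarrow> bool" where
  "equicontinuous_point T x \<longleftrightarrow>
     (\<forall>\<epsilon>>0. \<exists>\<delta>>0. \<forall>y. dist x y < \<delta> \<longrightarrow> (\<forall>i::nat. dist ((T ^^ i) x) ((T ^^ i) y) < \<epsilon>))"

definition pointwise_equicontinuous :: "('a::metric_space \<Rightarrow> 'a) \<Rightarrow> bool" where
  "pointwise_equicontinuous T \<longleftrightarrow> (\<forall>x. equicontinuous_point T x)"

definition borel_prob_measure :: "'a::metric_space measure \<Rightarrow> bool" where
  "borel_prob_measure \<mu> \<longleftrightarrow> prob_space \<mu> \<and> sets \<mu> = sets borel"

definition nonatomic :: "'a::metric_space measure \<Rightarrow> bool" where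
  "nonatomic \<mu> \<longleftrightarrow> (\<forall>x. emeasure \<mu> {x} = 0)"

(* emeasure is 0 on non-measurable sets, so this definition and the next one are
   meaningful only for Borel measurable T; pointwise equicontinuous maps are continuous. *)
definition invariant_measure :: "('a::metric_space \<Rightarrow> 'a) \<Rightarrow> 'a measure \<Rightarrow> bool" where
  "invariant_measure T \<mu> \<longleftrightarrow> (\<forall>B\<in>sets borel. emeasure \<mu> (T -` B) = emeasure \<mu> B)"

(* In ereal the supremum of the empty set is -\<infinity>. The radius \<epsilon> is uniform in x. *)
definition expansion_exponent :: "'a::metric_space measure \<Rightarrow> ('a \<Rightarrow> 'a) \<Rightarrow> ereal" where
  "expansion_exponent \<mu> T =
     Sup {ereal r | r :: real. \<exists>\<epsilon>>0. \<forall>x.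
            emeasure \<mu> {y \<in> ball x \<epsilon>. dist (T x) (T y) < exp r * dist x y} = 0}"

end

theory Submission
  imports Defs
begin

text \<open>
  Positive expansion exponent supplies some \<open>r > 0\<close> and a uniform radius \<open>\<epsilon>\<close> such that, around every
  \<open>x\<close>, the points \<open>y\<close> of \<open>ball x \<epsilon>\<close> with \<open>dist (T x) (T y) < exp r * dist x y\<close> form a null set
  \<open>N x\<close>. Equicontinuity at \<open>x\<close> supplies a ball around \<open>x\<close> whose points stay within \<open>\<epsilon>\<close> of the orbit
  of \<open>x\<close> for ever. A point \<open>y \<noteq> x\<close> of that ball cannot be pushed away from the orbit of \<open>x\<close> by the
  factor \<open>exp r\<close> at each step, since the distances would be unbounded; hence
  \<open>(T ^^ i) y \<in> N ((T ^^ i) x)\<close> for some \<open>i\<close> (lemma \<open>ball_subset_nonexpanding\<close>). By invariance the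
  preimages of the null sets \<open>N ((T ^^ i) x)\<close> are null, and \<open>{x}\<close> is null as the measure is
  nonatomic, so every point has a null neighbourhood. In a Lindelof space countably many of these
  cover everything (lemma \<open>Lindelof_UNIV_null\<close>), and the measure vanishes, which is absurd for a
  probability measure.
\<close>

lemma equicontinuous_point_isCont:
  assumes "equicontinuous_point T x"
  shows "isCont T x"
  unfolding continuous_at
proof (rule tendstoI)
  fix e :: real assume "e > 0"
  then obtain d where d: "d > 0"
      "\<And>y i. dist x y < d \<Longrightarrow> dist ((T ^^ i) x) ((T ^^ i) y) < e"
    using assms unfolding equicontinuous_point_def by meson
  have "dist (T y) (T x) < e" if "dist y x < d" for y
    using d(2)[of y 1] that by (simp add: dist_commute)
  then show "\<forall>\<^sub>F y in at x. dist (T y) (T x) < e"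
    using d(1) by (auto simp: eventually_at)
qed

lemma pointwise_equicontinuous_continuous_on:
  "pointwise_equicontinuous T \<Longrightarrow> continuous_on UNIV T"
  by (simp add: pointwise_equicontinuous_def equicontinuous_point_isCont continuous_at_imp_continuous_on)

definition nonexpanding :: "('a::metric_space \<Rightarrow> 'a) \<Rightarrow> real \<Rightarrow> real \<Rightarrow> 'a \<Rightarrow> 'a set" where
  "nonexpanding T c \<epsilon> x = {y \<in> ball x \<epsilon>. dist (T x) (T y) < c * dist x y}"

text \<open>Continuity of the map is what makes the vanishing of \<^const>\<open>emeasure\<close> on these sets
  meaningful: it ensures that they are Borel, even open.\<close>

lemma nonexpanding_borel:
  assumes "continuous_on UNIV T"
  shows "nonexpanding T c \<epsilon> x \<in> sets borel"
proof -
  have "nonexpanding T c \<epsilon> x = ball x \<epsilon> \<inter> {y. dist (T x) (T y) < c * dist x y}"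
    by (auto simp: nonexpanding_def)
  moreover have "open {y. dist (T x) (T y) < c * dist x y}"
    using assms by (intro open_Collect_less continuous_intros)
  ultimately show ?thesis by auto
qed

text \<open>The orbits of \<open>x\<close> and of a point \<open>y\<close> outside the right-hand side separate at least like
  \<open>c ^ i\<close>, yet they remain \<open>\<epsilon>\<close>-close. The conclusion is a plain inclusion, with a countable union
  on the right, so the measure enters only afterwards.\<close>

lemma ball_subset_nonexpanding:
  assumes "c > 1"
    and close: "\<And>y i. dist x y < \<delta> \<Longrightarrow> dist ((T ^^ i) x) ((T ^^ i) y) < \<epsilon>"
  shows "ball x \<delta> \<subseteq> {x} \<union> (\<Union>i. (T ^^ i) -` nonexpanding T c \<epsilon> ((T ^^ i) x))"
proof (rule subsetI, rule ccontr)
  fix y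
  assume y: "y \<in> ball x \<delta>"
    and out: "y \<notin> {x} \<union> (\<Union>i. (T ^^ i) -` nonexpanding T c \<epsilon> ((T ^^ i) x))"
  have small: "dist ((T ^^ i) x) ((T ^^ i) y) < \<epsilon>" for i
    using close y by simp
  have expand: "c * dist ((T ^^ i) x) ((T ^^ i) y) \<le> dist ((T ^^ Suc i) x) ((T ^^ Suc i) y)" for i
  proof -
    have "(T ^^ i) y \<notin> nonexpanding T c \<epsilon> ((T ^^ i) x)"
      using out by blast
    then show ?thesis
      using small[of i] by (simp add: nonexpanding_def)
  qed
  have grow: "c ^ i * dist x y \<le> dist ((T ^^ i) x) ((T ^^ i) y)" for i
  proof (induction i)
    case (Suc i)
    have "c ^ Suc i * dist x y \<le> c * dist ((T ^^ i) x) ((T ^^ i) y)"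
      using Suc \<open>c > 1\<close> by (simp add: mult.assoc)
    then show ?case using expand[of i] by linarith
  qed simp
  have pos: "dist x y > 0" using out by auto
  obtain i where "\<epsilon> / dist x y < c ^ i"
    using real_arch_pow[OF \<open>c > 1\<close>] by blast
  then have "\<epsilon> < c ^ i * dist x y"
    using pos by (simp add: pos_divide_less_eq)
  then show False using grow[of i] small[of i] by linarith
qed

lemma invariant_vimage_funpow_null:
  assumes "sets \<mu> = sets borel" "invariant_measure T \<mu>" "continuous_on UNIV T"
    and "N \<in> null_sets \<mu>"
  shows "(T ^^ i) -` N \<in> null_sets \<mu>"
proof (induction i)
  case (Suc i)
  have N: "(T ^^ i) -` N \<in> sets borel"
    using Suc assms(1) by auto
  have "T \<in> borel_measurable borel"
    using assms(3) by (rule borel_measurable_continuous_onI)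
  then have "T -` ((T ^^ i) -` N) \<in> sets \<mu>"
    using N assms(1) by (simp add: measurable_sets_borel)
  moreover have "emeasure \<mu> (T -` ((T ^^ i) -` N)) = 0"
    using N Suc assms(2) by (auto simp: invariant_measure_def)
  moreover have "(T ^^ Suc i) -` N = T -` ((T ^^ i) -` N)"
    by (auto simp: funpow_swap1)
  ultimately show ?case by (metis null_setsI)
qed (use assms(4) in simp)

lemma Lindelof_UNIV_null:
  fixes \<mu> :: "'a::topological_space measure"
  assumes "Lindelof_space (euclidean :: 'a topology)"
    and nbhd: "\<And>x. \<exists>U. open U \<and> x \<in> U \<and> U \<in> null_sets \<mu>"
  shows "UNIV \<in> null_sets \<mu>"
proof -
  let ?\<U> = "{U. open U \<and> U \<in> null_sets \<mu>}"
  have "\<Union>?\<U> = UNIV"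
    using nbhd by blast
  then obtain \<V> where \<V>: "countable \<V>" "\<V> \<subseteq> ?\<U>" "\<Union>\<V> = UNIV"
    using assms(1) unfolding Lindelof_space_def
    by (metis (no_types, lifting) mem_Collect_eq open_openin topspace_euclidean)
  have "(\<Union>V\<in>\<V>. V) \<in> null_sets \<mu>"
    using \<V> by (intro null_sets_UN') auto
  then show ?thesis using \<V>(3) by simp
qed

theorem mainTheorem4:
  fixes T :: "'a::metric_space \<Rightarrow> 'a"
  assumes "Lindelof_space (euclidean :: 'a topology)"
    and "pointwise_equicontinuous T"
  shows "\<not> (\<exists>\<mu> :: 'a measure. borel_prob_measure \<mu> \<and> nonatomic \<mu> \<and> invariant_measure T \<mu>
            \<and> expansion_exponent \<mu> T > 0)"
proof
  assume "\<exists>\<mu> :: 'a measure. borel_prob_measure \<mu> \<and> nonatomic \<mu> \<and> invariant_measure T \<mu>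
            \<and> expansion_exponent \<mu> T > 0"
  then obtain \<mu> :: "'a measure" where prob: "prob_space \<mu>" and sets: "sets \<mu> = sets borel"
    and na: "nonatomic \<mu>" and inv: "invariant_measure T \<mu>" and E: "expansion_exponent \<mu> T > 0"
    unfolding borel_prob_measure_def by blast
  have cont: "continuous_on UNIV T"
    using assms(2) by (rule pointwise_equicontinuous_continuous_on)
  obtain r \<epsilon> :: real where "0 < ereal r" "\<epsilon> > 0"
    and zero: "\<And>x. emeasure \<mu> (nonexpanding T (exp r) \<epsilon> x) = 0"
    using E unfolding expansion_exponent_def nonexpanding_def less_Sup_iff by blast
  then have "exp r > 1" by simp
  have null: "nonexpanding T (exp r) \<epsilon> x \<in> null_sets \<mu>" for x
    using zero nonexpanding_borel[OF cont] sets by (simp add: null_setsI)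
  have "\<exists>U. open U \<and> x \<in> U \<and> U \<in> null_sets \<mu>" for x
  proof -
    obtain \<delta> where \<delta>: "\<delta> > 0" "\<And>y i. dist x y < \<delta> \<Longrightarrow> dist ((T ^^ i) x) ((T ^^ i) y) < \<epsilon>"
      using assms(2) \<open>\<epsilon> > 0\<close> unfolding pointwise_equicontinuous_def equicontinuous_point_def
      by meson
    have "{x} \<in> null_sets \<mu>"
      using na sets by (auto simp: nonatomic_def)
    moreover have "(\<Union>i. (T ^^ i) -` nonexpanding T (exp r) \<epsilon> ((T ^^ i) x)) \<in> null_sets \<mu>"
      by (intro null_sets_UN invariant_vimage_funpow_null sets inv cont null)
    ultimately have "{x} \<union> (\<Union>i. (T ^^ i) -` nonexpanding T (exp r) \<epsilon> ((T ^^ i) x)) \<in> null_sets \<mu>"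
      by (rule null_sets.Un)
    moreover have "ball x \<delta> \<in> sets \<mu>"
      using sets by simp
    moreover have "ball x \<delta> \<subseteq> {x} \<union> (\<Union>i. (T ^^ i) -` nonexpanding T (exp r) \<epsilon> ((T ^^ i) x))"
      using \<open>exp r > 1\<close> \<delta>(2) by (rule ball_subset_nonexpanding)
    ultimately have "ball x \<delta> \<in> null_sets \<mu>"
      by (rule null_sets_subset)
    then show ?thesis using \<delta>(1) by (intro exI[of _ "ball x \<delta>"]) simp
  qed
  then have "UNIV \<in> null_sets \<mu>"
    using assms(1) by (intro Lindelof_UNIV_null)
  moreover have "space \<mu> = UNIV"
    using sets_eq_imp_space_eq[OF sets] by simp
  ultimately show False
    using prob_space.emeasure_space_1[OF prob] by auto
qed

end
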